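(* Inside the $m\times\infty$ table, a nontrivial linear combination of columns entries is a constant if and only if $m\equiv1\pmod 4$, and the equation is given by $$\alpha_1\mathcal{C}(n,1)+\alpha_3\mathcal{C}(n,3)+\cdots+\alpha_{m-2}\mathcal{C}(n,m-2)+\alpha_m\mathcal{C}(n,m)=\lambda$$ for all $n\geq1$, where $\lambda\neq0$ is a fixed number and $\alpha_{2i+1}+\alpha_{m-2i}=(-1)^i\,2\lambda$ for all $i=0,\ldots,(m-1)/4$.
   Context: For an integer $m\geq1$, the $m\times\infty$ table has cells $(x,y)$ with column index $x\geq1$ and row index $1\leq y\leq m$. A lattice path in the table is a sequence $\nu_1,\ldots,\nu_r$ of cells with $\nu_{j+1}-\nu_j\in\{(1,-1),(1,0),(1,1)\}$ for all $j=1,\ldots,r-1$. $\mathcal{C}(x,y)=\mathcal{C}_m(x,y)$ denotes the number of lattice paths from the first column to the cell $(x,y)$. Thus $\mathcal{C}(1,y)=1$ for $1\leq y\leq m$ and, with the convention $\mathcal{C}(x,0)=\mathcal{C}(x,m+1)=0$, $\mathcal{C}(x+1,y)=\mathcal{C}(x,y-1)+\mathcal{C}(x,y)+\mathcal{C}(x,y+1)$ for all $x\geq1$ and $1\leq y\leq m$. A linear combination of columns entries is an expression $\alpha_1\mathcal{C}(n,1)+\cdots+\alpha_m\mathcal{C}(n,m)$ with coefficients $\alpha_1,\ldots,\alpha_m$ not depending on $n$; it is a constant if its value is the same for all $n\geq1$. Since the rows are symmetric, $\alpha_1\mathcal{C}(n,1)+\cdots+\alpha_m\mathcal{C}(n,m)=0$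 always holds when $\alpha_i+\alpha_{m+1-i}=0$ for all $i=1,\ldots,m$; such linear combinations are called trivial, and all others are nontrivial. *)

theory Defs
  imports Complex_Main "HOL-Library.Product_Plus"
begin

type_synonym cell = "int \<times> int"

definition table :: "nat \<Rightarrow> cell set" where
  "table m = {(x, y). 1 \<le> x \<and> 1 \<le> y \<and> y \<le> int m}"

definition lattice_path :: "nat \<Rightarrow> cell list \<Rightarrow> bool" where
  "lattice_path m \<nu> \<longleftrightarrow>
     \<nu> \<noteq> [] \<and> set \<nu> \<subseteq> table m \<and>
     successively (\<lambda>p q. q - p \<in> {(1, -1), (1, 0), (1, 1)}) \<nu>"

text \<open>The first component of a cell is its column. Outside the table (in particular for
  \<open>y = 0\<close> and \<open>y = m + 1\<close>) there are no paths, so the count is 0 there.\<close>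

definition path_count :: "nat \<Rightarrow> nat \<Rightarrow> nat \<Rightarrow> nat" where
  "path_count m x y =
     card {\<nu>. lattice_path m \<nu> \<and> fst (hd \<nu>) = 1 \<and> last \<nu> = (int x, int y)}"

text \<open>Only the coefficients with index in \<open>{1..m}\<close> matter.\<close>

definition column_comb :: "nat \<Rightarrow> (nat \<Rightarrow> 'a::field_char_0) \<Rightarrow> nat \<Rightarrow> 'a" where
  "column_comb m \<alpha> n = (\<Sum>i=1..m. \<alpha> i * of_nat (path_count m n i))"

definition constant_comb :: "nat \<Rightarrow> (nat \<Rightarrow> 'a::field_char_0) \<Rightarrow> bool" where
  "constant_comb m \<alpha> \<longleftrightarrow> (\<exists>c. \<forall>n\<ge>1. column_comb m \<alpha> n = c)"

definition trivial_comb :: "nat \<Rightarrow> (nat \<Rightarrow> 'a::field_char_0) \<Rightarrow> bool" where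
  "trivial_comb m \<alpha> \<longleftrightarrow> (\<forall>i\<in>{1..m}. \<alpha> i + \<alpha> (m + 1 - i) = 0)"

end

theory Submission
  imports Defs
begin

text \<open>
  Write \<open>C(n,i)\<close> for the path counts. The count vector of column \<open>n + 1\<close> arises from that of
  column \<open>n\<close> by applying \<open>I + A\<close>, where \<open>A\<close> is the adjacency matrix of the path graph on
  \<open>{1..m}\<close>. Since \<open>A\<close> is symmetric, it may be moved to the coefficients: the combination
  of column \<open>n + 1\<close> with coefficients \<open>\<alpha>\<close> equals that of column \<open>n\<close> with coefficients \<open>\<alpha>\<close> plus
  that of column \<open>n\<close> with coefficients \<open>A \<alpha>\<close> (lemma \<open>column_comb_Suc\<close>). So if \<open>\<alpha>\<close> gives a
  constant \<open>c\<close>, then \<open>A \<alpha>\<close> gives the constant \<open>0\<close>.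

  Put \<open>b(j) = \<alpha>(j) + \<alpha>(m + 1 - j)\<close>. Summing all coefficients of \<open>A \<alpha>\<close> counts every \<open>\<alpha>(i)\<close> twice,
  apart from the two ends, so the first column yields \<open>0 = 2 c - b(1)\<close>. Moreover
  \<open>b(j) + b(j + 2)\<close> is the value at \<open>j + 1\<close> of the analogous function for \<open>A \<alpha>\<close>, whose constant is
  \<open>0\<close>. Two-step induction on \<open>j\<close>, simultaneously for all \<open>\<alpha>\<close> and \<open>c\<close>, therefore gives
  \<open>b(j) = 2 c \<chi>(j)\<close> with \<open>\<chi> = 1, 0, -1, 0, 1, \<dots>\<close> (lemma \<open>constant_imp_pattern\<close>). Thus \<open>c = 0\<close>
  exactly for trivial combinations, and \<open>b(1) = b(m)\<close> forces \<open>\<chi>(m) = 1\<close>, that is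
  \<open>m \<equiv> 1 (mod 4)\<close>, when \<open>c \<noteq> 0\<close>.

  Conversely, for \<open>m \<equiv> 1 (mod 4)\<close> the function \<open>\<chi>\<close> vanishes at \<open>0\<close> and \<open>m + 1\<close> and satisfies
  \<open>\<chi>(i - 1) + \<chi>(i + 1) = 0\<close>, so \<open>A \<chi> = 0\<close> and the combination with coefficients \<open>\<chi>\<close> is constant,
  with value \<open>\<chi>(1) + \<dots> + \<chi>(m) = 1\<close>. By the symmetry of the columns, only \<open>b\<close> matters for the value
  of a combination, which gives the converse in general.
\<close>

section \<open>Recurrence and symmetry of the path counts\<close>

text \<open>The lattice paths from the first column to the cell \<open>(x, y)\<close>; there are none if the cell
  lies outside the table.\<close>

definition paths_to :: "nat \<Rightarrow> nat \<Rightarrow> nat \<Rightarrow> cell list set" where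
  "paths_to m x y = {\<nu>. lattice_path m \<nu> \<and> fst (hd \<nu>) = 1 \<and> last \<nu> = (int x, int y)}"

lemma path_count_eq_card: "path_count m x y = card (paths_to m x y)"
  by (simp add: path_count_def paths_to_def)

lemma lattice_path_singleton [simp]: "lattice_path m [p] \<longleftrightarrow> p \<in> table m"
  by (simp add: lattice_path_def)

lemma lattice_path_snoc:
  assumes "\<nu> \<noteq> []"
  shows "lattice_path m (\<nu> @ [p]) \<longleftrightarrow>
    lattice_path m \<nu> \<and> p \<in> table m \<and> p - last \<nu> \<in> {(1, -1), (1, 0), (1, 1)}"
  using assms by (auto simp: lattice_path_def successively_append_iff)

lemma lattice_path_column:
  assumes "lattice_path m \<nu>"
  shows "fst (last \<nu>) = fst (hd \<nu>) + int (length \<nu>) - 1"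
  using assms
proof (induction \<nu> rule: rev_induct)
  case (snoc p \<nu>)
  show ?case
  proof (cases "\<nu> = []")
    case False
    with snoc.prems have "lattice_path m \<nu>" and "fst p = fst (last \<nu>) + 1"
      by (auto simp: lattice_path_snoc minus_prod_def prod_eq_iff)
    with snoc.IH False show ?thesis by (simp add: hd_append)
  qed simp
qed (simp add: lattice_path_def)

lemma paths_to_outside: "y = 0 \<or> y > m \<Longrightarrow> paths_to m x y = {}"
  by (auto simp: paths_to_def lattice_path_def table_def dest!: last_in_set)

lemma paths_to_first:
  assumes "1 \<le> y" "y \<le> m"
  shows "paths_to m 1 y = {[(1, int y)]}"
proof (intro equalityI subsetI)
  fix \<nu> assume "\<nu> \<in> paths_to m 1 y"
  then have \<nu>: "lattice_path m \<nu>" "fst (hd \<nu>) = 1" "last \<nu> = (1, int y)"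
    by (auto simp: paths_to_def)
  from lattice_path_column[OF \<nu>(1)] \<nu> have "length \<nu> = Suc 0" by simp
  with \<nu>(3) show "\<nu> \<in> {[(1, int y)]}" by (auto simp: length_Suc_conv)
qed (use assms in \<open>auto simp: paths_to_def table_def\<close>)

lemma paths_to_Suc:
  assumes "1 \<le> x" "1 \<le> y" "y \<le> m"
  shows "paths_to m (Suc x) y =
    (\<lambda>\<nu>. \<nu> @ [(int (Suc x), int y)]) ` (\<Union>z\<in>{y - 1, y, y + 1}. paths_to m x z)"
proof (intro equalityI subsetI)
  fix \<nu> assume "\<nu> \<in> paths_to m (Suc x) y"
  then have \<nu>: "lattice_path m \<nu>" "fst (hd \<nu>) = 1" "last \<nu> = (int (Suc x), int y)"
    by (auto simp: paths_to_def)
  from \<nu>(1) have "\<nu> \<noteq> []" by (simp add: lattice_path_def)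
  then obtain \<mu> where \<mu>: "\<nu> = \<mu> @ [(int (Suc x), int y)]"
    using \<nu>(3) by (metis append_butlast_last_id)
  have ne: "\<mu> \<noteq> []" using \<nu>(2) \<mu> assms(1) by auto
  have *: "lattice_path m \<mu>" "(int (Suc x), int y) - last \<mu> \<in> {(1, -1), (1, 0), (1, 1)}"
    using \<nu>(1) lattice_path_snoc[OF ne] \<mu> by auto
  then have "last \<mu> \<in> {(int x, int (y - 1)), (int x, int y), (int x, int (y + 1))}"
    using assms(2) by (cases "last \<mu>") auto
  moreover have "fst (hd \<mu>) = 1" using \<nu>(2) \<mu> ne by simp
  ultimately show "\<nu> \<in> (\<lambda>\<nu>. \<nu> @ [(int (Suc x), int y)]) ` (\<Union>z\<in>{y - 1, y, y + 1}. paths_to m x z)"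
    using *(1) \<mu> by (auto simp: paths_to_def)
next
  fix \<nu>
  assume "\<nu> \<in> (\<lambda>\<nu>. \<nu> @ [(int (Suc x), int y)]) ` (\<Union>z\<in>{y - 1, y, y + 1}. paths_to m x z)"
  then obtain \<mu> z where z: "z \<in> {y - 1, y, y + 1}" and "\<mu> \<in> paths_to m x z"
    and \<nu>: "\<nu> = \<mu> @ [(int (Suc x), int y)]" by blast
  then have \<mu>: "lattice_path m \<mu>" "fst (hd \<mu>) = 1" "last \<mu> = (int x, int z)"
    by (auto simp: paths_to_def)
  from \<mu>(1) have ne: "\<mu> \<noteq> []" by (simp add: lattice_path_def)
  have "(int (Suc x), int y) \<in> table m" using assms by (simp add: table_def)
  moreover have "(int (Suc x), int y) - last \<mu> \<in> {(1, -1), (1, 0), (1, 1)}"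
    using \<mu>(3) z assms(2) by auto
  ultimately have "lattice_path m \<nu>" using \<mu>(1) ne by (simp add: \<nu> lattice_path_snoc)
  then show "\<nu> \<in> paths_to m (Suc x) y" using \<mu>(2) ne by (simp add: \<nu> paths_to_def)
qed

lemma finite_paths_to:
  assumes "1 \<le> x"
  shows "finite (paths_to m x y)"
  using assms
proof (induction x arbitrary: y rule: nat_induct_at_least)
  case base
  then show ?case
    using paths_to_first[of y m] paths_to_outside[of y m 1] by (cases "1 \<le> y \<and> y \<le> m") auto
next
  case (Suc x)
  then show ?case
    using paths_to_Suc[of x y m] paths_to_outside[of y m "Suc x"]
    by (cases "1 \<le> y \<and> y \<le> m") auto
qed

lemma path_count_outside: "y = 0 \<or> y > m \<Longrightarrow> path_count m x y = 0"
  by (simp add: path_count_eq_card paths_to_outside)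

lemma path_count_first: "1 \<le> y \<Longrightarrow> y \<le> m \<Longrightarrow> path_count m 1 y = 1"
  using paths_to_first[of y m] by (simp add: path_count_eq_card)

lemma path_count_Suc:
  assumes "1 \<le> x" "1 \<le> y" "y \<le> m"
  shows "path_count m (Suc x) y =
    path_count m x (y - 1) + path_count m x y + path_count m x (y + 1)"
proof -
  have disj: "paths_to m x z \<inter> paths_to m x z' = {}" if "z \<noteq> z'" for z z'
    using that by (auto simp: paths_to_def)
  have "path_count m (Suc x) y = card (\<Union>z\<in>{y - 1, y, y + 1}. paths_to m x z)"
    unfolding path_count_eq_card paths_to_Suc[OF assms]
    by (intro card_image) (auto simp: inj_on_def)
  also have "\<dots> = (\<Sum>z\<in>{y - 1, y, y + 1}. path_count m x z)"
    unfolding path_count_eq_card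
    using assms(1) by (intro card_UN_disjoint) (auto simp: finite_paths_to disj)
  also have "\<dots> = path_count m x (y - 1) + path_count m x y + path_count m x (y + 1)"
    using assms(2) by (cases y) simp_all
  finally show ?thesis .
qed

lemma path_count_reflect:
  assumes "1 \<le> x" "y \<le> m + 1"
  shows "path_count m x (m + 1 - y) = path_count m x y"
  using assms
proof (induction x arbitrary: y rule: nat_induct_at_least)
  case base
  then show ?case
    using path_count_first[of y m] path_count_first[of "m + 1 - y" m]
    by (cases "1 \<le> y \<and> y \<le> m") (auto simp: path_count_outside)
next
  case (Suc x)
  show ?case
  proof (cases "1 \<le> y \<and> y \<le> m")
    case True
    then have "m + 1 - y - 1 = m + 1 - (y + 1)" "m + 1 - y + 1 = m + 1 - (y - 1)" by auto
    then have "path_count m (Suc x) (m + 1 - y) = path_count m x (m + 1 - (y + 1)) +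
        path_count m x (m + 1 - y) + path_count m x (m + 1 - (y - 1))"
      using True Suc.hyps path_count_Suc[of x "m + 1 - y" m] by (auto simp del: One_nat_def)
    also have "\<dots> = path_count m x (y + 1) + path_count m x y + path_count m x (y - 1)"
    proof -
      have "y + 1 \<le> m + 1" "y \<le> m + 1" "y - 1 \<le> m + 1" using True by auto
      then show ?thesis by (simp only: Suc.IH)
    qed
    also have "\<dots> = path_count m (Suc x) y"
      using True Suc.hyps path_count_Suc[of x y m] by simp
    finally show ?thesis .
  next
    case False
    with Suc.prems show ?thesis by (auto simp: path_count_outside)
  qed
qed

section \<open>Moving the adjacency matrix to the coefficients\<close>

text \<open>Coefficients cut off to zero outside \<open>{1..m}\<close>.\<close>

definition cutoff :: "nat \<Rightarrow> (nat \<Rightarrow> 'a::field_char_0) \<Rightarrow> nat \<Rightarrow> 'a" where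
  "cutoff m \<alpha> i = (if 1 \<le> i \<and> i \<le> m then \<alpha> i else 0)"

text \<open>The adjacency matrix of the path graph on \<open>{1..m}\<close>, applied to a coefficient vector. Only
  the values at indices in \<open>{1..m}\<close> are meaningful.\<close>

definition adj :: "nat \<Rightarrow> (nat \<Rightarrow> 'a::field_char_0) \<Rightarrow> nat \<Rightarrow> 'a" where
  "adj m \<alpha> i = cutoff m \<alpha> (i - 1) + cutoff m \<alpha> (i + 1)"

text \<open>The adjacency matrix is symmetric.\<close>

lemma sum_adj:
  fixes f :: "nat \<Rightarrow> 'a::field_char_0"
  assumes "f 0 = 0" "f (Suc m) = 0"
  shows "(\<Sum>i=1..m. adj m \<alpha> i * f i) = (\<Sum>i=1..m. \<alpha> i * (f (i - 1) + f (i + 1)))"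
proof -
  let ?a = "cutoff m \<alpha>"
  have a0: "?a 0 = 0" "?a (Suc m) = 0" by (auto simp: cutoff_def)
  have up: "(\<Sum>i=1..m. g (i - 1) * h i) = (\<Sum>i=1..m. g i * h (i + 1))"
    if "g 0 = 0" "h (Suc m) = 0" for g h :: "nat \<Rightarrow> 'a"
  proof -
    have "(\<Sum>i=1..m. g (i - 1) * h i) = (\<Sum>i=Suc 0..Suc m. g (i - 1) * h i)"
      using that by simp
    also have "\<dots> = (\<Sum>i=0..m. g i * h (Suc i))"
      by (subst sum.shift_bounds_cl_Suc_ivl) simp
    also have "\<dots> = (\<Sum>i=1..m. g i * h (i + 1))"
      using that by (simp add: sum.atLeast_Suc_atMost)
    finally show ?thesis .
  qed
  have "(\<Sum>i=1..m. adj m \<alpha> i * f i) =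
      (\<Sum>i=1..m. ?a (i - 1) * f i) + (\<Sum>i=1..m. f i * ?a (i + 1))"
    by (simp add: adj_def algebra_simps sum.distrib)
  also have "\<dots> = (\<Sum>i=1..m. ?a i * f (i + 1)) + (\<Sum>i=1..m. f (i - 1) * ?a i)"
    using up[of ?a f] up[of f ?a] a0 assms by simp
  also have "\<dots> = (\<Sum>i=1..m. ?a i * (f (i - 1) + f (i + 1)))"
    by (simp add: algebra_simps sum.distrib)
  also have "\<dots> = (\<Sum>i=1..m. \<alpha> i * (f (i - 1) + f (i + 1)))"
    by (intro sum.cong) (auto simp: cutoff_def)
  finally show ?thesis .
qed

lemma column_comb_Suc:
  assumes "1 \<le> n"
  shows "column_comb m \<alpha> (Suc n) = column_comb m \<alpha> n + column_comb m (adj m \<alpha>) n"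
proof -
  have "column_comb m \<alpha> (Suc n) = (\<Sum>i=1..m. \<alpha> i * of_nat (path_count m n i) +
      \<alpha> i * (of_nat (path_count m n (i - 1)) + of_nat (path_count m n (i + 1))))"
    unfolding column_comb_def
    using assms by (intro sum.cong) (simp_all add: path_count_Suc[simplified] algebra_simps)
  also have "\<dots> = column_comb m \<alpha> n + column_comb m (adj m \<alpha>) n"
    unfolding column_comb_def sum.distrib
    by (subst sum_adj) (simp_all add: path_count_outside)
  finally show ?thesis .
qed

lemma column_comb_1: "column_comb m \<alpha> 1 = (\<Sum>i=1..m. \<alpha> i)"
  unfolding column_comb_def by (intro sum.cong) (auto simp: path_count_first[simplified])

text \<open>The all-one vector is mapped by the adjacency matrix to \<open>2\<close> everywhere, less \<open>1\<close> for each
  end of the path graph that a vertex coincides with; for \<open>m = 1\<close> both ends coincide.\<close>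

lemma sum_adj_eq:
  assumes "m \<ge> 1"
  shows "(\<Sum>i=1..m. adj m \<alpha> i) = 2 * (\<Sum>i=1..m. \<alpha> i) - (\<alpha> 1 + \<alpha> m)"
proof -
  define f :: "nat \<Rightarrow> 'a" where "f = (\<lambda>i. if 1 \<le> i \<and> i \<le> m then 1 else 0)"
  have "(\<Sum>i=1..m. adj m \<alpha> i) = (\<Sum>i=1..m. adj m \<alpha> i * f i)"
    by (intro sum.cong) (auto simp: f_def)
  also have "\<dots> = (\<Sum>i=1..m. \<alpha> i * (f (i - 1) + f (i + 1)))"
    by (intro sum_adj) (auto simp: f_def)
  also have "\<dots> = (\<Sum>i=1..m. 2 * \<alpha> i - (if i = 1 then \<alpha> i else 0) - (if i = m then \<alpha> i else 0))"
    by (intro sum.cong) (auto simp: f_def)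
  also have "\<dots> = 2 * (\<Sum>i=1..m. \<alpha> i) - (\<alpha> 1 + \<alpha> m)"
    using assms by (simp add: sum_subtractf sum_distrib_left)
  finally show ?thesis .
qed

section \<open>The coefficients of a constant combination\<close>

text \<open>The sequence \<open>0, 1, 0, -1, 0, 1, \<dots>\<close>, starting at index \<open>0\<close>.\<close>

definition chi :: "nat \<Rightarrow> 'a::field_char_0" where
  "chi j = (if even j then 0 else (-1) ^ (j div 2))"

lemma chi_Suc_Suc [simp]: "chi (Suc (Suc j)) = - chi j"
  by (simp add: chi_def)

lemma chi_0 [simp]: "chi 0 = 0" and chi_1 [simp]: "chi (Suc 0) = 1"
  by (simp_all add: chi_def)

lemma chi_odd [simp]: "chi (2 * i + 1) = (-1) ^ i" "chi (Suc (2 * i)) = (-1) ^ i"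
  by (simp_all add: chi_def)

lemma chi_eq_1_iff: "(chi j :: 'a::field_char_0) = 1 \<longleftrightarrow> j mod 4 = 1"
proof -
  have "(- 1 :: 'a) \<noteq> 1"
    using one_neq_neg_one by metis
  then have *: "(-1 :: 'a) ^ i = 1 \<longleftrightarrow> even i" for i
    by (cases "even i") auto
  have "(chi j :: 'a) = 1 \<longleftrightarrow> odd j \<and> even (j div 2)"
    by (simp add: chi_def *)
  also have "\<dots> \<longleftrightarrow> j mod 4 = 1" by presburger
  finally show ?thesis .
qed

lemma chi_reflect:
  assumes "m mod 4 = 1" "j \<le> m + 1"
  shows "chi (m + 1 - j) = chi j"
proof (cases "even j")
  case False
  then obtain i where j: "j = 2 * i + 1" by (elim oddE)
  define k where "k = m div 4"
  have m: "m = 4 * k + 1" using assms(1) unfolding k_def by presburger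
  have "m + 1 - j = 2 * (2 * k - i) + 1" using assms(2) m j by auto
  moreover have "even (2 * k - i) \<longleftrightarrow> even i" using assms(2) m j by auto
  ultimately show ?thesis using j by (simp add: uminus_power_if)
qed (use assms in \<open>auto simp: chi_def, presburger+\<close>)

lemma constant_imp_pattern:
  assumes "m \<ge> 1" "\<And>n. n \<ge> 1 \<Longrightarrow> column_comb m \<alpha> n = c" "1 \<le> j" "j \<le> m"
  shows "\<alpha> j + \<alpha> (m + 1 - j) = 2 * c * chi j"
proof -
  let ?b = "\<lambda>\<alpha> j. cutoff m \<alpha> j + cutoff m \<alpha> (m + 1 - j)"
  have "?b \<alpha> j = 2 * c * chi j"
    if "\<And>n. n \<ge> 1 \<Longrightarrow> column_comb m \<alpha> n = c" "j \<le> m" for \<alpha> :: "nat \<Rightarrow> 'a" and c j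
    using that
  proof (induction j arbitrary: \<alpha> c rule: induct_nat_012)
    case 0
    then show ?case by (simp add: cutoff_def)
  next
    case 1
    have "column_comb m (adj m \<alpha>) 1 = 0"
      using column_comb_Suc[of 1 m \<alpha>] 1 by simp
    then have "\<alpha> 1 + \<alpha> m = 2 * c"
      using sum_adj_eq[OF assms(1), of \<alpha>] 1(1)[of 1] by (simp add: column_comb_1[simplified])
    then show ?case using assms(1) by (simp add: cutoff_def)
  next
    case (ge2 j)
    have "column_comb m (adj m \<alpha>) n = 0" if "n \<ge> 1" for n
      using column_comb_Suc[of n m \<alpha>] ge2.prems(1) that by simp
    then have "?b (adj m \<alpha>) (Suc j) = 2 * 0 * chi (Suc j)"
      using ge2.prems(2) by (intro ge2.IH(2)) auto
    moreover have "?b (adj m \<alpha>) (Suc j) = ?b \<alpha> j + ?b \<alpha> (Suc (Suc j))"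
      using ge2.prems(2) by (auto simp: cutoff_def adj_def Suc_diff_Suc Suc_diff_le)
    moreover have "?b \<alpha> j = 2 * c * chi j"
      using ge2.prems by (intro ge2.IH(1)) auto
    ultimately have "2 * c * chi j + ?b \<alpha> (Suc (Suc j)) = 0" by simp
    then show ?case by (simp add: add_eq_0_iff)
  qed
  from this[of \<alpha> c j] assms show ?thesis by (auto simp: cutoff_def split: if_splits)
qed

text \<open>For \<open>m \<equiv> 1 (mod 4)\<close> the pattern is realised by \<open>\<chi>\<close>, which lies in the kernel of the
  adjacency matrix.\<close>

lemma column_comb_chi:
  assumes "m mod 4 = 1" "n \<ge> 1"
  shows "column_comb m chi n = 1"
  using assms(2)
proof (induction n rule: nat_induct_at_least)
  case base
  define k where "k = m div 4"
  have m: "m = 4 * k + 1" using assms(1) unfolding k_def by presburger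
  have "(\<Sum>i=1..4 * k + 1. chi i) = (1 :: 'a)"
  proof (induction k)
    case (Suc k)
    have "4 * Suc k + 1 = Suc (Suc (Suc (Suc (4 * k + 1))))" by simp
    then show ?case using Suc by (simp only: sum.cl_ivl_Suc chi_Suc_Suc) simp
  qed simp
  then show ?case unfolding column_comb_1 m .
next
  case (Suc n)
  have "adj m chi i = (0 :: 'a)" if i: "i \<in> {1..m}" for i
  proof -
    have "chi (m + 1) = (0 :: 'a)" using chi_reflect[OF assms(1), of 0] by simp
    then have cut: "cutoff m chi j = (chi j :: 'a)" if "j \<le> m + 1" for j
      using that by (cases "j = 0 \<or> j = m + 1") (auto simp: cutoff_def)
    obtain j where "i = Suc j" using i by (cases i) auto
    then show ?thesis using i cut[of "i - 1"] cut[of "i + 1"] by (simp add: adj_def)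
  qed
  then have "column_comb m (adj m chi) n = (0 :: 'a)"
    by (simp add: column_comb_def)
  with Suc show ?case by (simp add: column_comb_Suc)
qed

lemma pattern_imp_constant:
  assumes m: "m mod 4 = 1" and n: "n \<ge> 1"
    and pattern: "\<And>j. 1 \<le> j \<Longrightarrow> j \<le> m \<Longrightarrow> \<alpha> j + \<alpha> (m + 1 - j) = 2 * c * chi j"
  shows "column_comb m \<alpha> n = c"
proof -
  have "column_comb m \<alpha> n = (\<Sum>i=1..m. \<alpha> (m + 1 - i) * of_nat (path_count m n (m + 1 - i)))"
    unfolding column_comb_def by (subst sum.atLeastAtMost_rev) simp
  also have "\<dots> = (\<Sum>i=1..m. \<alpha> (m + 1 - i) * of_nat (path_count m n i))"
    using n by (intro sum.cong refl) (simp del: One_nat_def add: path_count_reflect)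
  finally have "2 * column_comb m \<alpha> n =
      (\<Sum>i=1..m. (\<alpha> i + \<alpha> (m + 1 - i)) * of_nat (path_count m n i))"
    by (simp add: column_comb_def sum.distrib distrib_right)
  also have "\<dots> = (\<Sum>i=1..m. 2 * c * (chi i * of_nat (path_count m n i)))"
    using pattern by (intro sum.cong refl) (simp add: mult.assoc)
  also have "\<dots> = 2 * c"
    using column_comb_chi[OF m n, where 'a = 'a]
    unfolding sum_distrib_left[symmetric] column_comb_def by simp
  finally show ?thesis by simp
qed

text \<open>The conditions on the odd indices up to the middle row, together with those on the even
  indices, amount to the full pattern, because \<open>\<chi>\<close> is symmetric about the middle row.\<close>

lemma pattern_iff:
  fixes \<alpha> :: "nat \<Rightarrow> 'a::field_char_0"
  assumes m: "m mod 4 = 1"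
  shows "trivial_comb m (\<lambda>i. if even i then \<alpha> i else 0) \<and>
      (\<forall>i\<le>(m - 1) div 4. \<alpha> (2 * i + 1) + \<alpha> (m - 2 * i) = (-1) ^ i * (2 * c)) \<longleftrightarrow>
    (\<forall>j. 1 \<le> j \<longrightarrow> j \<le> m \<longrightarrow> \<alpha> j + \<alpha> (m + 1 - j) = 2 * c * chi j)"
    (is "?triv \<and> ?odd \<longleftrightarrow> ?pat")
proof -
  define k where "k = m div 4"
  have k: "m = 4 * k + 1" using m unfolding k_def by presburger
  show ?thesis
  proof (intro iffI conjI)
    assume pat: ?pat
    show ?triv
      unfolding trivial_comb_def
    proof
      fix i assume i: "i \<in> {1..m}"
      then have "even (m + 1 - i) \<longleftrightarrow> even i" using k by auto
      then show "(if even i then \<alpha> i else 0) +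
          (if even (m + 1 - i) then \<alpha> (m + 1 - i) else 0) = 0"
        using pat i by (auto simp: chi_def)
    qed
    show ?odd
    proof (intro allI impI)
      fix i assume "i \<le> (m - 1) div 4"
      then show "\<alpha> (2 * i + 1) + \<alpha> (m - 2 * i) = (-1) ^ i * (2 * c)"
        using pat[rule_format, of "2 * i + 1"] k by simp
    qed
  next
    assume asm: "?triv \<and> ?odd"
    have low: "\<alpha> j + \<alpha> (m + 1 - j) = 2 * c * chi j" if "odd j" "j \<le> 2 * k + 1" for j
    proof -
      from \<open>odd j\<close> obtain i where "j = 2 * i + 1" by (elim oddE)
      with asm that k show ?thesis by simp
    qed
    show ?pat
    proof (intro allI impI)
      fix j assume j: "1 \<le> j" "j \<le> m"
      have par: "even (m + 1 - j) \<longleftrightarrow> even j" using j k by auto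
      consider "even j" | "odd j" "j \<le> 2 * k + 1" | "odd j" "j > 2 * k + 1" by linarith
      then show "\<alpha> j + \<alpha> (m + 1 - j) = 2 * c * chi j"
      proof cases
        case 1
        from asm j have "(if even j then \<alpha> j else 0) +
            (if even (m + 1 - j) then \<alpha> (m + 1 - j) else 0) = 0"
          by (simp add: trivial_comb_def)
        with 1 show ?thesis unfolding par by (simp add: chi_def)
      next
        case 2
        then show ?thesis by (rule low)
      next
        case 3
        then have "\<alpha> (m + 1 - j) + \<alpha> (m + 1 - (m + 1 - j)) = 2 * c * chi (m + 1 - j)"
          using par k by (intro low) auto
        then show ?thesis using j chi_reflect[OF m, of j, where 'a = 'a] by (simp add: add.commute)
      qed
    qed
  qed
qed

theorem theorem2p1:
  fixes m :: nat
  assumes "m \<ge> 1"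
  shows
    "((\<exists>\<alpha> :: nat \<Rightarrow> 'a::field_char_0. \<not> trivial_comb m \<alpha> \<and> constant_comb m \<alpha>) \<longleftrightarrow> m mod 4 = 1)
     \<and> (\<forall>(\<alpha> :: nat \<Rightarrow> 'a) c.
          (\<not> trivial_comb m \<alpha> \<and> (\<forall>n\<ge>1. column_comb m \<alpha> n = c)) \<longleftrightarrow>
          (m mod 4 = 1 \<and> c \<noteq> 0
           \<and> trivial_comb m (\<lambda>i. if even i then \<alpha> i else 0)
           \<and> (\<forall>i\<le>(m - 1) div 4. \<alpha> (2 * i + 1) + \<alpha> (m - 2 * i) = (-1) ^ i * (2 * c))))
     \<and> (\<forall>(\<alpha> :: nat \<Rightarrow> 'a) c.
          m mod 4 = 1 \<and> c \<noteq> 0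
          \<and> (\<forall>i\<le>(m - 1) div 4. \<alpha> (2 * i + 1) + \<alpha> (m - 2 * i) = (-1) ^ i * (2 * c)) \<longrightarrow>
          (\<forall>n\<ge>1. (\<Sum>i | i \<in> {1..m} \<and> odd i. \<alpha> i * of_nat (path_count m n i)) = c))"
    (is "?exist \<and> ?char \<and> ?odd")
proof -
  let ?pat = "\<lambda>(\<alpha> :: nat \<Rightarrow> 'a) c.
    \<forall>j. 1 \<le> j \<longrightarrow> j \<le> m \<longrightarrow> \<alpha> j + \<alpha> (m + 1 - j) = 2 * c * chi j"
  have key: "(\<not> trivial_comb m \<alpha> \<and> (\<forall>n\<ge>1. column_comb m \<alpha> n = c)) \<longleftrightarrow>
      (m mod 4 = 1 \<and> c \<noteq> 0 \<and> ?pat \<alpha> c)" (is "?L \<longleftrightarrow> ?R") for \<alpha> :: "nat \<Rightarrow> 'a" and c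
  proof
    assume L: ?L
    then have pat: "?pat \<alpha> c" using constant_imp_pattern[OF assms, of \<alpha> c] by blast
    have "c \<noteq> 0"
    proof
      assume "c = 0"
      with pat have "trivial_comb m \<alpha>" by (simp add: trivial_comb_def)
      with L show False by blast
    qed
    \<comment> \<open>The pattern at the two ends of the column gives \<open>\<chi>(m) = \<chi>(1) = 1\<close>.\<close>
    have "2 * c * chi m = 2 * c * chi 1"
      using pat[rule_format, of m] pat[rule_format, of 1] assms by (simp add: add.commute)
    with \<open>c \<noteq> 0\<close> have "(chi m :: 'a) = 1" by simp
    with \<open>c \<noteq> 0\<close> pat show ?R by (simp add: chi_eq_1_iff)
  next
    assume R: ?R
    then have "\<alpha> 1 + \<alpha> (m + 1 - 1) = 2 * c * chi 1" and "c \<noteq> 0" using assms by blast+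
    then have "\<alpha> 1 + \<alpha> (m + 1 - 1) \<noteq> 0" by simp
    then have "\<not> trivial_comb m \<alpha>" using assms unfolding trivial_comb_def by force
    with R show ?L using pattern_imp_constant[of m _ \<alpha> c] by blast
  qed
  have ?exist
  proof
    assume "m mod 4 = 1"
    then have "?pat chi 1" by (simp add: chi_reflect[simplified] flip: mult_2)
    with \<open>m mod 4 = 1\<close> have "\<not> trivial_comb m (chi :: nat \<Rightarrow> 'a) \<and>
        (\<forall>n\<ge>1. column_comb m (chi :: nat \<Rightarrow> 'a) n = 1)"
      using key[of chi 1] by simp
    then show "\<exists>\<alpha> :: nat \<Rightarrow> 'a. \<not> trivial_comb m \<alpha> \<and> constant_comb m \<alpha>"
      unfolding constant_comb_def by blast
  qed (use key in \<open>auto simp: constant_comb_def\<close>)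
  moreover have ?char
    unfolding key using pattern_iff[of m] by blast
  moreover have ?odd
  proof (intro allI impI)
    fix \<alpha> :: "nat \<Rightarrow> 'a" and c n
    assume asm: "m mod 4 = 1 \<and> c \<noteq> 0 \<and>
      (\<forall>i\<le>(m - 1) div 4. \<alpha> (2 * i + 1) + \<alpha> (m - 2 * i) = (-1) ^ i * (2 * c))"
      and n: "(1::nat) \<le> n"
    \<comment> \<open>Dropping the even coefficients leaves a vector to which the full pattern applies.\<close>
    define \<beta> where "\<beta> = (\<lambda>i. if odd i then \<alpha> i else 0)"
    have "trivial_comb m (\<lambda>i. if even i then \<beta> i else 0)"
      by (simp add: trivial_comb_def \<beta>_def)
    moreover have "\<beta> (2 * i + 1) + \<beta> (m - 2 * i) = (-1) ^ i * (2 * c)"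
      if i: "i \<le> (m - 1) div 4" for i
    proof -
      have "m mod 4 = 1" using asm by blast
      then have "odd m" by presburger
      moreover have "2 * i \<le> m" using i by linarith
      ultimately have "odd (m - 2 * i)" by simp
      with asm i show ?thesis by (simp add: \<beta>_def)
    qed
    ultimately have "?pat \<beta> c" using asm pattern_iff[of m \<beta> c] by blast
    then have "column_comb m \<beta> n = c" using asm n pattern_imp_constant[of m n \<beta> c] by blast
    moreover have "(\<Sum>i | i \<in> {1..m} \<and> odd i. \<alpha> i * of_nat (path_count m n i)) =
        column_comb m \<beta> n"
      unfolding column_comb_def \<beta>_def
      by (intro sum.mono_neutral_cong_left) auto
    ultimately show "(\<Sum>i | i \<in> {1..m} \<and> odd i. \<alpha> i * of_nat (path_count m n i)) = c"
      by simp
  qed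
  ultimately show ?thesis by blast
qed

end
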